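(* Each of the logics $\mathrm{CONDEP}$, $\mathrm{CONINQ}$ and $\mathrm{PL}_{\to}(\Diamond_e)$ is expressively complete for the class $\mathbb{C}$ of all convex properties: for every finite $\mathsf{X}\subseteq\mathsf{P}$, the set $\{\|\phi\|_{\mathsf{X}} : \phi \text{ a formula of the logic}\}$ equals the set of all convex properties over $\mathsf{X}$.
   Context: Propositional team semantics: fix a countably infinite set $\mathsf{P}$ of propositional letters; a team over $\mathsf{X}\subseteq\mathsf{P}$ is a set $t\subseteq 2^{\mathsf{X}}$ of valuations. Truth clauses: $t\vDash p$ iff $v(p)=1$ for all $v\in t$; $t\vDash\bot$ iff $t=\emptyset$; $t\vDash\neg\alpha$ ($\alpha$ classical) iff $\{v\}\nvDash\alpha$ for all $v\in t$; $t\vDash\phi\wedge\psi$ iff both hold; $t\vDash\phi\,\dot\vee\,\psi$ iff there are $s,u$ with $s\vDash\phi$, $u\vDash\psi$ and $t\subseteq s\cup u$; $t\vDash\phi\to\psi$ iff for all $s\subseteq t$, $s\vDash\phi$ implies $s\vDash\psi$; $t\vDash {=}(p_1,\dots,p_n,p)$ iff for all $v,w\in t$, if $v(p_i)=w(p_i)$ for all $i$ then $v(p)=w(p)$; $t\vDash\Diamond_e\phi$ (the "epistemic might" operator) iff there is a nonempty $s\subseteq t$ with $s\vDash\phi$; $t\vDash\phi\,\dot\vee_g\,\psi$ (dotted global disjunction) iff there is $s\supseteq t$ with $s\vDash\phi$ or $s\vDash\psi$. The logics: $\mathrm{CONDEP}$: $\phi::= p\mid\bot\mid\phi\wedge\phi\mid\phi\,\dot\vee\,\phi\mid\neg\beta\mid{=}(p_1,\dots,p_n,p)\mid\Diamond_e\phi$,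 where $\beta$ ranges over classical formulas built from $p,\bot,\wedge,\dot\vee,\neg$; $\mathrm{CONINQ}$: $\phi::=p\mid\bot\mid\phi\wedge\phi\mid\phi\to\phi\mid\phi\,\dot\vee_g\,\phi\mid\Diamond_e\phi$; $\mathrm{PL}_{\to}(\Diamond_e)$: $\phi::=p\mid\bot\mid\phi\wedge\phi\mid\phi\to\phi\mid\Diamond_e\phi$. A property over $\mathsf{X}$ is a class of teams over $\mathsf{X}$; $\|\phi\|_{\mathsf{X}}:=\{t\subseteq 2^{\mathsf{X}}: t\vDash\phi\}$. A property $\mathcal{P}$ is convex if $s,t\in\mathcal{P}$ and $s\subseteq u\subseteq t$ imply $u\in\mathcal{P}$. *)

theory Defs
  imports "HOL-Library.FuncSet" "HOL-Library.Countable"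
begin

(* All connectives in one datatype, so that the truth clauses are given once;
   the individual logics are carved out below as sets of formulas. *)
datatype (letters: 'p) fm =
    Atom 'p
  | Bot
  | Neg "'p fm"
  | And "'p fm" "'p fm"
  | Or "'p fm" "'p fm"
  | Imp "'p fm" "'p fm"
  | GOr "'p fm" "'p fm"
  | Dep "'p list" 'p
  | Might "'p fm"

type_synonym 'p team = "('p \<Rightarrow> bool) set"

definition valuations :: "'p set \<Rightarrow> ('p \<Rightarrow> bool) set" where
  "valuations X = X \<rightarrow>\<^sub>E (UNIV :: bool set)"

definition teams :: "'p set \<Rightarrow> 'p team set" where
  "teams X = Pow (valuations X)"

(* Or and GOr are the dotted disjunctions: their witnesses need not be subteams of t,
   so truth depends on the set X over which teams are formed. *)
fun sat :: "'p set \<Rightarrow> 'p team \<Rightarrow> 'p fm \<Rightarrow> bool" where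
  "sat X t (Atom p) \<longleftrightarrow> (\<forall>v\<in>t. v p)"
| "sat X t Bot \<longleftrightarrow> t = {}"
| "sat X t (Neg \<alpha>) \<longleftrightarrow> (\<forall>v\<in>t. \<not> sat X {v} \<alpha>)"
| "sat X t (And \<phi> \<psi>) \<longleftrightarrow> sat X t \<phi> \<and> sat X t \<psi>"
| "sat X t (Or \<phi> \<psi>) \<longleftrightarrow>
     (\<exists>s\<in>teams X. \<exists>u\<in>teams X. sat X s \<phi> \<and> sat X u \<psi> \<and> t \<subseteq> s \<union> u)"
| "sat X t (Imp \<phi> \<psi>) \<longleftrightarrow> (\<forall>s\<subseteq>t. sat X s \<phi> \<longrightarrow> sat X s \<psi>)"
| "sat X t (GOr \<phi> \<psi>) \<longleftrightarrow> (\<exists>s\<in>teams X. t \<subseteq> s \<and> (sat X s \<phi> \<or> sat X s \<psi>))"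
| "sat X t (Dep ps p) \<longleftrightarrow>
     (\<forall>v\<in>t. \<forall>w\<in>t. (\<forall>q\<in>set ps. v q = w q) \<longrightarrow> v p = w p)"
| "sat X t (Might \<phi>) \<longleftrightarrow> (\<exists>s\<subseteq>t. s \<noteq> {} \<and> sat X s \<phi>)"

inductive_set classical :: "'p fm set" where
  "Atom p \<in> classical"
| "Bot \<in> classical"
| "\<alpha> \<in> classical \<Longrightarrow> \<beta> \<in> classical \<Longrightarrow> And \<alpha> \<beta> \<in> classical"
| "\<alpha> \<in> classical \<Longrightarrow> \<beta> \<in> classical \<Longrightarrow> Or \<alpha> \<beta> \<in> classical"
| "\<alpha> \<in> classical \<Longrightarrow> Neg \<alpha> \<in> classical"

(* The list ps may be empty, in which case Dep ps p is the constancy atom. *)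
inductive_set CONDEP :: "'p fm set" where
  "Atom p \<in> CONDEP"
| "Bot \<in> CONDEP"
| "\<phi> \<in> CONDEP \<Longrightarrow> \<psi> \<in> CONDEP \<Longrightarrow> And \<phi> \<psi> \<in> CONDEP"
| "\<phi> \<in> CONDEP \<Longrightarrow> \<psi> \<in> CONDEP \<Longrightarrow> Or \<phi> \<psi> \<in> CONDEP"
| "\<beta> \<in> classical \<Longrightarrow> Neg \<beta> \<in> CONDEP"
| "Dep ps p \<in> CONDEP"
| "\<phi> \<in> CONDEP \<Longrightarrow> Might \<phi> \<in> CONDEP"

inductive_set CONINQ :: "'p fm set" where
  "Atom p \<in> CONINQ"
| "Bot \<in> CONINQ"
| "\<phi> \<in> CONINQ \<Longrightarrow> \<psi> \<in> CONINQ \<Longrightarrow> And \<phi> \<psi> \<in> CONINQ"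
| "\<phi> \<in> CONINQ \<Longrightarrow> \<psi> \<in> CONINQ \<Longrightarrow> Imp \<phi> \<psi> \<in> CONINQ"
| "\<phi> \<in> CONINQ \<Longrightarrow> \<psi> \<in> CONINQ \<Longrightarrow> GOr \<phi> \<psi> \<in> CONINQ"
| "\<phi> \<in> CONINQ \<Longrightarrow> Might \<phi> \<in> CONINQ"

inductive_set PL_imp_might :: "'p fm set" where
  "Atom p \<in> PL_imp_might"
| "Bot \<in> PL_imp_might"
| "\<phi> \<in> PL_imp_might \<Longrightarrow> \<psi> \<in> PL_imp_might \<Longrightarrow> And \<phi> \<psi> \<in> PL_imp_might"
| "\<phi> \<in> PL_imp_might \<Longrightarrow> \<psi> \<in> PL_imp_might \<Longrightarrow> Imp \<phi> \<psi> \<in> PL_imp_might"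
| "\<phi> \<in> PL_imp_might \<Longrightarrow> Might \<phi> \<in> PL_imp_might"

definition ext :: "'p set \<Rightarrow> 'p fm \<Rightarrow> 'p team set" where
  "ext X \<phi> = {t \<in> teams X. sat X t \<phi>}"

definition convex_property :: "'p team set \<Rightarrow> bool" where
  "convex_property \<P> \<longleftrightarrow>
     (\<forall>s t u. s \<in> \<P> \<and> t \<in> \<P> \<and> s \<subseteq> u \<and> u \<subseteq> t \<longrightarrow> u \<in> \<P>)"

(* A valuation over X assigns no value to letters outside X,
   hence only formulas with letters in X are evaluated over X. *)
definition expressively_complete :: "'p fm set \<Rightarrow> ('p team set \<Rightarrow> bool) \<Rightarrow> bool" where
  "expressively_complete L C \<longleftrightarrow>
     (\<forall>X. finite X \<longrightarrow>
        {ext X \<phi> | \<phi>. \<phi> \<in> L \<and> letters \<phi> \<subseteq> X} = {\<P>. \<P> \<subseteq> teams X \<and> C \<P>})"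

end

theory Submission
  imports Defs
begin

text \<open>
  Every connective other than conjunction yields a downward closed or an upward closed property,
  so every formula is convex. Conversely, a nonempty convex property over a finite set of letters
  is the intersection of its downward closure \<open>D\<close> and its upward closure \<open>U\<close>, and both are
  intersections over finitely many excluded teams: \<open>t \<in> D\<close> iff no team \<open>s \<notin> D\<close> is contained
  in \<open>t\<close>, and \<open>t \<in> U\<close> iff \<open>t\<close> is contained in no team \<open>s \<notin> U\<close>. The condition
  \<open>\<not> t \<subseteq> s\<close> says that some nonempty subteam of \<open>t\<close> avoids every element of \<open>s\<close>, so with
  conjunction and \<open>Might\<close> it suffices to express \<open>\<not> s \<subseteq> t\<close> for nonempty \<open>s\<close>.
  With implication, this says that no nonempty subteam of \<open>t\<close> contains every element of \<open>s\<close>,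
  and \<open>v \<in> t\<close> is expressed by \<open>Might\<close>. With dependence atoms, it says that \<open>t\<close> is covered by
  a team avoiding \<open>s\<close> and \<open>card s - 1\<close> teams with at most one element.
\<close>

section \<open>Convexity of every formula\<close>

text \<open>Only \<open>And\<close> uses the induction hypotheses: every other clause is monotone or
  antitone in the team, whatever its subformulas mean.\<close>

lemma sat_convex:
  "\<lbrakk>sat X s \<phi>; sat X t \<phi>; s \<subseteq> u; u \<subseteq> t\<rbrakk> \<Longrightarrow> sat X u \<phi>"
proof (induction \<phi> arbitrary: s t u)
  case (And \<phi> \<psi>)
  then show ?case unfolding sat.simps by blast
next
  case (Imp \<phi> \<psi>)
  from Imp.prems show ?case unfolding sat.simps by (meson subset_trans)
next
  case (Or \<phi> \<psi>)
  from Or.prems show ?case unfolding sat.simps by (meson subset_trans)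
next
  case (GOr \<phi> \<psi>)
  from GOr.prems show ?case unfolding sat.simps by (meson subset_trans)
next
  case (Might \<phi>)
  from Might.prems show ?case unfolding sat.simps by (meson subset_trans)
next
  case (Neg \<phi>)
  from Neg.prems show ?case unfolding sat.simps by blast
next
  case (Dep ps p)
  from Dep.prems show ?case unfolding sat.simps by blast
qed auto

section \<open>Definable predicates on teams\<close>

text \<open>Speaking of predicates instead of formulas lets closure properties be chained without
  displaying the formulas.\<close>

definition definable :: "'p fm set \<Rightarrow> 'p set \<Rightarrow> ('p team \<Rightarrow> bool) \<Rightarrow> bool" where
  "definable L X Q \<longleftrightarrow>
     (\<exists>\<phi>\<in>L. letters \<phi> \<subseteq> X \<and> (\<forall>t\<in>teams X. sat X t \<phi> \<longleftrightarrow> Q t))"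

lemma definableI:
  "\<lbrakk>\<phi> \<in> L; letters \<phi> \<subseteq> X; \<And>t. t \<in> teams X \<Longrightarrow> sat X t \<phi> \<longleftrightarrow> Q t\<rbrakk> \<Longrightarrow> definable L X Q"
  unfolding definable_def by blast

lemma definable_cong:
  "\<lbrakk>definable L X Q; \<And>t. t \<in> teams X \<Longrightarrow> Q t \<longleftrightarrow> R t\<rbrakk> \<Longrightarrow> definable L X R"
  unfolding definable_def by auto

lemma definable_mono: "\<lbrakk>definable L X Q; L \<subseteq> M\<rbrakk> \<Longrightarrow> definable M X Q"
  unfolding definable_def by blast

text \<open>By \<open>sat_convex\<close> no fragment can define a non-convex property, so only the
  converse inclusion is left to each logic.\<close>

lemma expressively_completeI:
  assumes "\<And>X \<P>. \<lbrakk>finite X; \<P> \<subseteq> teams X; convex_property \<P>\<rbrakk> \<Longrightarrow> definable L X (\<lambda>t. t \<in> \<P>)"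
  shows "expressively_complete L convex_property"
  unfolding expressively_complete_def
proof (intro allI impI equalityI subsetI)
  fix X :: "'a set" and \<P>
  assume "\<P> \<in> {ext X \<phi> |\<phi>. \<phi> \<in> L \<and> letters \<phi> \<subseteq> X}"
  then obtain \<phi> where \<P>: "\<P> = ext X \<phi>" by blast
  have "convex_property \<P>"
    unfolding convex_property_def \<P> ext_def teams_def using sat_convex[of X _ \<phi>] by blast
  then show "\<P> \<in> {\<P>. \<P> \<subseteq> teams X \<and> convex_property \<P>}"
    unfolding \<P> ext_def by blast
next
  fix X :: "'a set" and \<P>
  assume "finite X" and \<P>: "\<P> \<in> {\<P>. \<P> \<subseteq> teams X \<and> convex_property \<P>}"
  then have "definable L X (\<lambda>t. t \<in> \<P>)" using assms by blast
  then obtain \<phi> where \<phi>: "\<phi> \<in> L" "letters \<phi> \<subseteq> X"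
    "\<And>t. t \<in> teams X \<Longrightarrow> sat X t \<phi> \<longleftrightarrow> t \<in> \<P>"
    unfolding definable_def by blast
  then have "\<P> = ext X \<phi>" using \<P> unfolding ext_def by blast
  then show "\<P> \<in> {ext X \<phi> |\<phi>. \<phi> \<in> L \<and> letters \<phi> \<subseteq> X}" using \<phi> by blast
qed

lemma finite_valuations: "finite X \<Longrightarrow> finite (valuations X)"
  unfolding valuations_def by (simp add: finite_PiE)

lemma finite_teams: "finite X \<Longrightarrow> finite (teams X)"
  unfolding teams_def by (simp add: finite_valuations)

lemma finite_team: "\<lbrakk>finite X; t \<in> teams X\<rbrakk> \<Longrightarrow> finite t"
  unfolding teams_def using finite_valuations finite_subset by blast

lemma subset_team: "\<lbrakk>s \<subseteq> t; t \<in> teams X\<rbrakk> \<Longrightarrow> s \<in> teams X"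
  unfolding teams_def by blast

text \<open>Both functions take the same default value outside \<open>X\<close>, so agreement on
  \<open>X\<close> suffices.\<close>

lemma valuation_eqI:
  "\<lbrakk>v \<in> valuations X; w \<in> valuations X; \<And>p. p \<in> X \<Longrightarrow> v p = w p\<rbrakk> \<Longrightarrow> v = w"
  unfolding valuations_def by (rule PiE_ext)

section \<open>Closure of definability under connectives\<close>

lemma definable_And:
  assumes "\<And>\<phi> \<psi>. \<lbrakk>\<phi> \<in> L; \<psi> \<in> L\<rbrakk> \<Longrightarrow> And \<phi> \<psi> \<in> L" "definable L X Q" "definable L X R"
  shows "definable L X (\<lambda>t. Q t \<and> R t)"
proof -
  obtain \<phi> \<psi> where "\<phi> \<in> L" "letters \<phi> \<subseteq> X" "\<forall>t\<in>teams X. sat X t \<phi> \<longleftrightarrow> Q t"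
    "\<psi> \<in> L" "letters \<psi> \<subseteq> X" "\<forall>t\<in>teams X. sat X t \<psi> \<longleftrightarrow> R t"
    using assms(2,3) unfolding definable_def by blast
  then show ?thesis by (intro definableI[of "And \<phi> \<psi>"]) (auto intro: assms(1))
qed

text \<open>The assumption on \<open>True\<close> covers the empty conjunction, as the grammars have
  no constant for truth.\<close>

lemma definable_Ball:
  assumes "\<And>\<phi> \<psi>. \<lbrakk>\<phi> \<in> L; \<psi> \<in> L\<rbrakk> \<Longrightarrow> And \<phi> \<psi> \<in> L" "definable L X (\<lambda>t. True)"
    "finite I" "\<And>i. i \<in> I \<Longrightarrow> definable L X (Q i)"
  shows "definable L X (\<lambda>t. \<forall>i\<in>I. Q i t)"
  using assms(3,4)
proof (induction I rule: finite_induct)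
  case empty
  then show ?case using assms(2) by simp
next
  case (insert i I)
  then have "definable L X (\<lambda>t. Q i t \<and> (\<forall>i\<in>I. Q i t))"
    by (intro definable_And assms(1)) auto
  then show ?case by simp
qed

lemma definable_Might:
  assumes "\<And>\<phi>. \<phi> \<in> L \<Longrightarrow> Might \<phi> \<in> L" "definable L X Q"
  shows "definable L X (\<lambda>t. \<exists>s\<subseteq>t. s \<noteq> {} \<and> Q s)"
proof -
  obtain \<phi> where "\<phi> \<in> L" "letters \<phi> \<subseteq> X" "\<forall>t\<in>teams X. sat X t \<phi> \<longleftrightarrow> Q t"
    using assms(2) unfolding definable_def by blast
  then show ?thesis
    by (intro definableI[of "Might \<phi>"]) (auto intro: assms(1) dest: subset_team)
qed

text \<open>For nonempty \<open>s\<close>, this intuitionistic negation turns the upward closed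
  condition \<open>s \<subseteq> t\<close> into its downward closed complement.\<close>

lemma definable_imp_Bot:
  assumes "\<And>\<phi> \<psi>. \<lbrakk>\<phi> \<in> L; \<psi> \<in> L\<rbrakk> \<Longrightarrow> Imp \<phi> \<psi> \<in> L" "Bot \<in> L" "definable L X Q"
  shows "definable L X (\<lambda>t. \<forall>s\<subseteq>t. Q s \<longrightarrow> s = {})"
proof -
  obtain \<phi> where "\<phi> \<in> L" "letters \<phi> \<subseteq> X" "\<forall>t\<in>teams X. sat X t \<phi> \<longleftrightarrow> Q t"
    using assms(3) unfolding definable_def by blast
  then show ?thesis
    by (intro definableI[of "Imp \<phi> Bot"]) (auto intro: assms(1,2) dest: subset_team)
qed

lemma definable_Or:
  assumes "\<And>\<phi> \<psi>. \<lbrakk>\<phi> \<in> L; \<psi> \<in> L\<rbrakk> \<Longrightarrow> Or \<phi> \<psi> \<in> L" "definable L X Q" "definable L X R"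
  shows "definable L X (\<lambda>t. \<exists>s\<in>teams X. \<exists>u\<in>teams X. Q s \<and> R u \<and> t \<subseteq> s \<union> u)"
proof -
  obtain \<phi> \<psi> where "\<phi> \<in> L" "letters \<phi> \<subseteq> X" "\<forall>t\<in>teams X. sat X t \<phi> \<longleftrightarrow> Q t"
    "\<psi> \<in> L" "letters \<psi> \<subseteq> X" "\<forall>t\<in>teams X. sat X t \<psi> \<longleftrightarrow> R t"
    using assms(2,3) unfolding definable_def by blast
  then show ?thesis by (intro definableI[of "Or \<phi> \<psi>"]) (auto intro: assms(1))
qed

section \<open>Convex properties from excluded teams\<close>

text \<open>This isolates what the logics share: apart from its grammar, each has to supply only
  truth and \<open>not_subset\<close>.\<close>

lemma definable_convex:
  assumes conj: "\<And>\<phi> \<psi>. \<lbrakk>\<phi> \<in> L; \<psi> \<in> L\<rbrakk> \<Longrightarrow> And \<phi> \<psi> \<in> L"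
    and might: "\<And>\<phi>. \<phi> \<in> L \<Longrightarrow> Might \<phi> \<in> L"
    and bot: "Bot \<in> L"
    and top: "definable L X (\<lambda>t. True)"
    and not_subset: "\<And>s. \<lbrakk>s \<in> teams X; s \<noteq> {}\<rbrakk> \<Longrightarrow> definable L X (\<lambda>t. \<not> s \<subseteq> t)"
    and X: "finite X" and \<P>: "\<P> \<subseteq> teams X" "convex_property \<P>"
  shows "definable L X (\<lambda>t. t \<in> \<P>)"
proof (cases "\<P> = {}")
  case True
  \<comment> \<open>\<open>Might Bot\<close> holds of no team, whereas \<open>Bot\<close> still
    holds of the empty one.\<close>
  have "Might Bot \<in> L" by (intro might bot)
  then show ?thesis using True by (intro definableI[of "Might Bot"]) auto
next
  case False
  define D where "D = {t \<in> teams X. \<exists>u\<in>\<P>. t \<subseteq> u}"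
  define U where "U = {t \<in> teams X. \<exists>s\<in>\<P>. s \<subseteq> t}"
  \<comment> \<open>Hence no team outside \<open>D\<close> is empty, as \<open>not_subset\<close>
    requires.\<close>
  have "{} \<in> D" using False unfolding D_def teams_def by blast
  then have down: "definable L X (\<lambda>t. \<forall>s\<in>teams X - D. \<not> s \<subseteq> t)"
    using X by (intro definable_Ball conj top not_subset) (auto simp: finite_teams)
  have avoid: "definable L X (\<lambda>t. v \<notin> t)" if "v \<in> valuations X" for v
    using not_subset[of "{v}"] that by (auto simp: teams_def)
  have not_contained: "definable L X (\<lambda>t. \<not> t \<subseteq> s)" if s: "s \<in> teams X" for s
  proof -
    have "definable L X (\<lambda>t. \<forall>v\<in>s. v \<notin> t)"
      using s X by (intro definable_Ball conj top avoid) (auto simp: finite_team teams_def)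
    then have "definable L X (\<lambda>t. \<exists>r\<subseteq>t. r \<noteq> {} \<and> (\<forall>v\<in>s. v \<notin> r))"
      by (intro definable_Might might)
    moreover have "(\<exists>r\<subseteq>t. r \<noteq> {} \<and> (\<forall>v\<in>s. v \<notin> r)) \<longleftrightarrow> \<not> t \<subseteq> s" for t
    proof
      assume "\<not> t \<subseteq> s"
      \<comment> \<open>The largest subteam avoiding \<open>s\<close> is the witness.\<close>
      then have "t - s \<subseteq> t \<and> t - s \<noteq> {} \<and> (\<forall>v\<in>s. v \<notin> t - s)" by blast
      then show "\<exists>r\<subseteq>t. r \<noteq> {} \<and> (\<forall>v\<in>s. v \<notin> r)" by blast
    qed blast
    ultimately show ?thesis by simp
  qed
  have up: "definable L X (\<lambda>t. \<forall>s\<in>teams X - U. \<not> t \<subseteq> s)"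
    using X by (intro definable_Ball conj top not_contained) (auto simp: finite_teams)
  have "definable L X (\<lambda>t. (\<forall>s\<in>teams X - D. \<not> s \<subseteq> t) \<and> (\<forall>s\<in>teams X - U. \<not> t \<subseteq> s))"
    by (intro definable_And conj down up)
  then show ?thesis
  proof (rule definable_cong)
    fix t assume t: "t \<in> teams X"
    \<comment> \<open>If \<open>t \<notin> D\<close>, then \<open>t\<close> itself is an excluded
      team contained in \<open>t\<close>; conversely \<open>D\<close> is closed under
      subteams.\<close>
    have "(\<forall>s\<in>teams X - D. \<not> s \<subseteq> t) \<longleftrightarrow> t \<in> D"
      using t unfolding D_def by blast
    moreover have "(\<forall>s\<in>teams X - U. \<not> t \<subseteq> s) \<longleftrightarrow> t \<in> U"
      using t unfolding U_def by blast
    \<comment> \<open>Convexity enters here: \<open>t\<close> lies between two members of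
      \<open>\<P>\<close>.\<close>
    moreover have "t \<in> D \<and> t \<in> U \<longleftrightarrow> t \<in> \<P>"
      using t \<P>(2) unfolding D_def U_def convex_property_def by blast
    ultimately show "(\<forall>s\<in>teams X - D. \<not> s \<subseteq> t) \<and> (\<forall>s\<in>teams X - U. \<not> t \<subseteq> s) \<longleftrightarrow> t \<in> \<P>"
      by blast
  qed
qed

text \<open>The conjunction of the literals true at \<open>v\<close> leaves no other valuation over
  \<open>X\<close>. Literals are assumed definable because the logics express negation
  differently.\<close>

lemma definable_subset_singleton:
  assumes "\<And>\<phi> \<psi>. \<lbrakk>\<phi> \<in> L; \<psi> \<in> L\<rbrakk> \<Longrightarrow> And \<phi> \<psi> \<in> L" "definable L X (\<lambda>t. True)"
    and pos: "\<And>p. p \<in> X \<Longrightarrow> definable L X (\<lambda>t. \<forall>v\<in>t. v p)"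
    and neg: "\<And>p. p \<in> X \<Longrightarrow> definable L X (\<lambda>t. \<forall>v\<in>t. \<not> v p)"
    and "finite X" and v: "v \<in> valuations X"
  shows "definable L X (\<lambda>t. t \<subseteq> {v})"
proof -
  have "definable L X (\<lambda>t. \<forall>w\<in>t. w p = v p)" if "p \<in> X" for p
    using pos[OF that] neg[OF that] by (cases "v p") auto
  then have "definable L X (\<lambda>t. \<forall>p\<in>X. \<forall>w\<in>t. w p = v p)"
    using assms(1,2,5) by (intro definable_Ball)
  then show ?thesis
  proof (rule definable_cong)
    fix t assume "t \<in> teams X"
    then have "t \<subseteq> valuations X" unfolding teams_def by blast
    then show "(\<forall>p\<in>X. \<forall>w\<in>t. w p = v p) \<longleftrightarrow> t \<subseteq> {v}"
      using valuation_eqI[OF _ v] by blast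
  qed
qed

context
  fixes X :: "'p set"
  assumes X: "finite X"
begin

section \<open>Excluding a team by implication\<close>

lemma PL_imp_might_top: "definable PL_imp_might X (\<lambda>t. True)"
  by (intro definableI[of "Imp Bot Bot"]) (auto intro: PL_imp_might.intros)

text \<open>Only \<open>{}\<close> and \<open>{v}\<close> are subteams of \<open>{v}\<close>, and
  \<open>Might\<close> discards the empty one.\<close>

lemma PL_imp_might_contains:
  assumes "v \<in> valuations X"
  shows "definable PL_imp_might X (\<lambda>t. v \<in> t)"
proof -
  have pos: "definable PL_imp_might X (\<lambda>t. \<forall>v\<in>t. v p)" if "p \<in> X" for p
    using that by (intro definableI[of "Atom p"]) (auto intro: PL_imp_might.intros)
  have "definable PL_imp_might X (\<lambda>t. \<forall>v\<in>t. \<not> v p)" if "p \<in> X" for p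
  proof -
    have "definable PL_imp_might X (\<lambda>t. \<forall>s\<subseteq>t. (\<forall>v\<in>s. v p) \<longrightarrow> s = {})"
      by (intro definable_imp_Bot pos that PL_imp_might.intros)
    then show ?thesis
    proof (rule definable_cong)
      fix t :: "'p team"
      show "(\<forall>s\<subseteq>t. (\<forall>v\<in>s. v p) \<longrightarrow> s = {}) \<longleftrightarrow> (\<forall>v\<in>t. \<not> v p)"
      proof (intro iffI ballI)
        fix v assume "\<forall>s\<subseteq>t. (\<forall>v\<in>s. v p) \<longrightarrow> s = {}" "v \<in> t"
        \<comment> \<open>A valuation making \<open>p\<close> true would give the nonempty subteam
          \<open>{v}\<close>.\<close>
        then show "\<not> v p" by (auto dest: spec[of _ "{v}"])
      qed blast
    qed
  qed
  then have "definable PL_imp_might X (\<lambda>t. t \<subseteq> {v})"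
    using assms X by (intro definable_subset_singleton pos PL_imp_might_top PL_imp_might.intros)
  then have "definable PL_imp_might X (\<lambda>t. \<exists>s\<subseteq>t. s \<noteq> {} \<and> s \<subseteq> {v})"
    by (intro definable_Might PL_imp_might.intros)
  then show ?thesis by (rule definable_cong) blast
qed

text \<open>Containing \<open>s\<close> passes to superteams, so a subteam of \<open>t\<close>
  contains \<open>s\<close> only if \<open>t\<close> does; as \<open>s\<close> is nonempty, so is
  any such subteam, which the negation forbids.\<close>

lemma PL_imp_might_not_subset:
  assumes "s \<in> teams X" "s \<noteq> {}"
  shows "definable PL_imp_might X (\<lambda>t. \<not> s \<subseteq> t)"
proof -
  have "definable PL_imp_might X (\<lambda>t. \<forall>v\<in>s. v \<in> t)"
    using assms X
    by (intro definable_Ball PL_imp_might_contains PL_imp_might_top PL_imp_might.intros)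
      (auto simp: teams_def finite_team)
  then have "definable PL_imp_might X (\<lambda>t. \<forall>r\<subseteq>t. (\<forall>v\<in>s. v \<in> r) \<longrightarrow> r = {})"
    by (intro definable_imp_Bot PL_imp_might.intros)
  then show ?thesis by (rule definable_cong) (use assms(2) in blast)
qed

section \<open>Excluding a team by dependence atoms\<close>

text \<open>The defining formula has to be classical because \<open>CONDEP\<close> allows
  \<open>Neg\<close> only on such formulas.\<close>

lemma classical_subset_singleton:
  assumes "v \<in> valuations X"
  shows "definable classical X (\<lambda>t. t \<subseteq> {v})"
proof (rule definable_subset_singleton)
  show "definable classical X (\<lambda>t. True)"
    by (intro definableI[of "Neg Bot"]) (auto intro: classical.intros)
  show "definable classical X (\<lambda>t. \<forall>v\<in>t. v p)" if "p \<in> X" for p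
    using that by (intro definableI[of "Atom p"]) (auto intro: classical.intros)
  show "definable classical X (\<lambda>t. \<forall>v\<in>t. \<not> v p)" if "p \<in> X" for p
    using that by (intro definableI[of "Neg (Atom p)"]) (auto intro: classical.intros)
qed (use assms X in \<open>auto intro: classical.intros\<close>)

lemma CONDEP_top: "definable CONDEP X (\<lambda>t. True)"
  by (intro definableI[of "Neg Bot"]) (auto intro: CONDEP.intros classical.intros)

text \<open>\<open>Neg\<close> tests singletons, and \<open>{w} \<subseteq> {v}\<close> only for
  \<open>w = v\<close>.\<close>

lemma CONDEP_avoid:
  assumes "v \<in> valuations X"
  shows "definable CONDEP X (\<lambda>t. v \<notin> t)"
proof -
  obtain \<beta> where \<beta>: "\<beta> \<in> classical" "letters \<beta> \<subseteq> X"
    "\<And>t. t \<in> teams X \<Longrightarrow> sat X t \<beta> \<longleftrightarrow> t \<subseteq> {v}"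
    using classical_subset_singleton[OF assms] unfolding definable_def by blast
  show ?thesis
  proof (rule definableI[of "Neg \<beta>"])
    fix t assume "t \<in> teams X"
    then have "sat X {w} \<beta> \<longleftrightarrow> w = v" if "w \<in> t" for w
      using \<beta>(3)[of "{w}"] that unfolding teams_def by auto
    then show "sat X t (Neg \<beta>) \<longleftrightarrow> v \<notin> t" by auto
  qed (use \<beta> in \<open>auto intro: CONDEP.intros\<close>)
qed

text \<open>\<open>Dep [] p\<close> says that \<open>p\<close> is constant; if every letter in
  \<open>X\<close> is constant, at most one valuation remains.\<close>

lemma CONDEP_card_le_1: "definable CONDEP X (\<lambda>t. card t \<le> 1)"
proof -
  have "definable CONDEP X (\<lambda>t. \<forall>p\<in>X. \<forall>v\<in>t. \<forall>w\<in>t. v p = w p)"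
  proof (intro definable_Ball CONDEP_top X CONDEP.intros)
    fix p assume "p \<in> X"
    then show "definable CONDEP X (\<lambda>t. \<forall>v\<in>t. \<forall>w\<in>t. v p = w p)"
      by (intro definableI[of "Dep [] p"]) (auto intro: CONDEP.intros)
  qed
  then show ?thesis
  proof (rule definable_cong)
    fix t assume t: "t \<in> teams X"
    then have "t \<subseteq> valuations X" "finite t" using X finite_team by (auto simp: teams_def)
    then have "card t \<le> 1 \<longleftrightarrow> (\<forall>v\<in>t. \<forall>w\<in>t. v = w)"
      by (simp add: card_le_Suc0_iff_eq)
    also have "\<dots> \<longleftrightarrow> (\<forall>p\<in>X. \<forall>v\<in>t. \<forall>w\<in>t. v p = w p)"
    proof (intro iffI ballI)
      fix v w assume *: "\<forall>p\<in>X. \<forall>v\<in>t. \<forall>w\<in>t. v p = w p" "v \<in> t" "w \<in> t"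
      then have "v \<in> valuations X" "w \<in> valuations X" using \<open>t \<subseteq> valuations X\<close> by auto
      then show "v = w" using * by (intro valuation_eqI[of v X w]) auto
    qed auto
    finally show "(\<forall>p\<in>X. \<forall>v\<in>t. \<forall>w\<in>t. v p = w p) \<longleftrightarrow> card t \<le> 1" by simp
  qed
qed

text \<open>Each further disjunct with at most one valuation raises the bound by one.\<close>

lemma CONDEP_card_le: "definable CONDEP X (\<lambda>t. card t \<le> n)"
proof (induction n)
  case 0
  \<comment> \<open>Teams over a finite \<open>X\<close> are finite, so cardinality \<open>0\<close>
    does mean empty.\<close>
  show ?case using X
    by (intro definableI[of Bot]) (auto intro: CONDEP.intros dest: finite_team)
next
  case (Suc n)
  have "definable CONDEP X
    (\<lambda>t. \<exists>s\<in>teams X. \<exists>u\<in>teams X. card s \<le> n \<and> card u \<le> 1 \<and> t \<subseteq> s \<union> u)"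
    by (intro definable_Or Suc.IH CONDEP_card_le_1 CONDEP.intros)
  then show ?case
  proof (rule definable_cong)
    fix t assume t: "t \<in> teams X"
    show "(\<exists>s\<in>teams X. \<exists>u\<in>teams X. card s \<le> n \<and> card u \<le> 1 \<and> t \<subseteq> s \<union> u) \<longleftrightarrow> card t \<le> Suc n"
    proof
      assume "\<exists>s\<in>teams X. \<exists>u\<in>teams X. card s \<le> n \<and> card u \<le> 1 \<and> t \<subseteq> s \<union> u"
      then obtain s u where su: "s \<in> teams X" "u \<in> teams X" "card s \<le> n" "card u \<le> 1"
        "t \<subseteq> s \<union> u" by blast
      then have "card t \<le> card (s \<union> u)" using X by (intro card_mono) (auto simp: finite_team)
      also have "\<dots> \<le> card s + card u" by (rule card_Un_le)
      finally show "card t \<le> Suc n" using su by simp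
    next
      assume le: "card t \<le> Suc n"
      show "\<exists>s\<in>teams X. \<exists>u\<in>teams X. card s \<le> n \<and> card u \<le> 1 \<and> t \<subseteq> s \<union> u"
      proof (cases "t = {}")
        case True
        then show ?thesis using t by (intro bexI[of _ "{}"]) auto
      next
        case False
        then obtain v where v: "v \<in> t" by blast
        have "card (t - {v}) \<le> n" using v le by (simp add: card_Diff_singleton)
        moreover have "t - {v} \<in> teams X" "{v} \<in> teams X"
          using t v by (auto simp: teams_def)
        moreover have "card {v} \<le> 1" "t \<subseteq> (t - {v}) \<union> {v}" by auto
        ultimately show ?thesis by blast
      qed
    qed
  qed
qed

text \<open>If \<open>t\<close> misses a point of \<open>s\<close>, then \<open>t \<inter> s\<close>
  is small and \<open>t - s\<close> avoids \<open>s\<close>. If \<open>s \<subseteq> t\<close>, the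
  small part of any such cover would have to contain all of \<open>s\<close>.\<close>

lemma CONDEP_not_subset:
  assumes s: "s \<in> teams X" "s \<noteq> {}"
  shows "definable CONDEP X (\<lambda>t. \<not> s \<subseteq> t)"
proof -
  have fin: "finite s" using s X by (simp add: finite_team)
  have "definable CONDEP X (\<lambda>t. \<forall>v\<in>s. v \<notin> t)"
    using s fin by (intro definable_Ball CONDEP_avoid CONDEP_top CONDEP.intros)
      (auto simp: teams_def)
  then have "definable CONDEP X
    (\<lambda>t. \<exists>a\<in>teams X. \<exists>b\<in>teams X. card a \<le> card s - 1 \<and> (\<forall>v\<in>s. v \<notin> b) \<and> t \<subseteq> a \<union> b)"
    by (intro definable_Or CONDEP_card_le CONDEP.intros)
  then show ?thesis
  proof (rule definable_cong)
    fix t assume t: "t \<in> teams X"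
    have "(\<exists>a\<in>teams X. \<exists>b\<in>teams X. card a \<le> card s - 1 \<and> (\<forall>v\<in>s. v \<notin> b) \<and> t \<subseteq> a \<union> b)"
      if "\<not> s \<subseteq> t"
    proof (rule bexI[of _ "t \<inter> s"], rule bexI[of _ "t - s"], intro conjI)
      have "card (t \<inter> s) < card s" using that fin by (intro psubset_card_mono) auto
      then show "card (t \<inter> s) \<le> card s - 1" by simp
    qed (use t in \<open>auto simp: teams_def\<close>)
    moreover have "\<not> s \<subseteq> t"
      if ab: "a \<in> teams X" "card a \<le> card s - 1" "\<forall>v\<in>s. v \<notin> b" "t \<subseteq> a \<union> b" for a b
    proof
      assume "s \<subseteq> t"
      then have "s \<subseteq> a" using ab by blast
      then have "card s \<le> card a" using ab X by (intro card_mono) (auto simp: finite_team)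
      \<comment> \<open>Positivity keeps the truncated \<open>card s - 1\<close> strictly below
        \<open>card s\<close>.\<close>
      moreover have "card s > 0" using s fin by (simp add: card_gt_0_iff)
      ultimately show False using ab by simp
    qed
    ultimately show "(\<exists>a\<in>teams X. \<exists>b\<in>teams X. card a \<le> card s - 1 \<and> (\<forall>v\<in>s. v \<notin> b) \<and> t \<subseteq> a \<union> b)
      \<longleftrightarrow> \<not> s \<subseteq> t"
      by blast
  qed
qed

section \<open>Completeness of the three logics\<close>

lemma PL_imp_might_definable_convex:
  "\<lbrakk>\<P> \<subseteq> teams X; convex_property \<P>\<rbrakk> \<Longrightarrow> definable PL_imp_might X (\<lambda>t. t \<in> \<P>)"
  by (intro definable_convex PL_imp_might_top PL_imp_might_not_subset X PL_imp_might.intros)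

lemma CONDEP_definable_convex:
  "\<lbrakk>\<P> \<subseteq> teams X; convex_property \<P>\<rbrakk> \<Longrightarrow> definable CONDEP X (\<lambda>t. t \<in> \<P>)"
  by (intro definable_convex CONDEP_top CONDEP_not_subset X CONDEP.intros)

end

text \<open>\<open>CONINQ\<close> extends the grammar by \<open>GOr\<close>, so definability carries
  over; that \<open>GOr\<close> leads to nothing non-convex is part of
  \<open>sat_convex\<close>.\<close>

lemma PL_imp_might_subset_CONINQ: "PL_imp_might \<subseteq> CONINQ"
proof
  show "\<phi> \<in> CONINQ" if "\<phi> \<in> PL_imp_might" for \<phi> :: "'p fm"
    using that by induction (auto intro: CONINQ.intros)
qed

theorem theorem2p17:
  assumes "infinite (UNIV :: ('p :: countable) set)"
  shows "expressively_complete (CONDEP :: 'p fm set) convex_property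
       \<and> expressively_complete (CONINQ :: 'p fm set) convex_property
       \<and> expressively_complete (PL_imp_might :: 'p fm set) convex_property"
proof (intro conjI expressively_completeI)
  fix X :: "'p set" and \<P>
  assume *: "finite X" "\<P> \<subseteq> teams X" "convex_property \<P>"
  then show "definable CONDEP X (\<lambda>t. t \<in> \<P>)" by (rule CONDEP_definable_convex)
  from * show PL: "definable PL_imp_might X (\<lambda>t. t \<in> \<P>)" by (rule PL_imp_might_definable_convex)
  then show "definable CONINQ X (\<lambda>t. t \<in> \<P>)"
    using PL_imp_might_subset_CONINQ by (rule definable_mono)
qed

end
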